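(* Consider a sequence of integers $n$ and numbers $p=p(n)\in(0,1)$ such that $pn$ is an integer and $p(1-p)n\to\infty$. For each $n$ in the sequence let $f=f_n\colon\{0,1\}^n\to\mathbb R$ be a function with $\|f\|_\infty\le1$ depending on at most $m=m(n)$ coordinates, where $m(n)=o(p(1-p)n)$. Then $$\bigl|\mathbb E_{\nu_{pn}}[f]-\mathbb E_{\mu_p}[f]\bigr|=o(1).$$
   Context: For an integer $0\le k\le n$, $\nu_k$ is the uniform probability measure on the slice $\{x\in\{0,1\}^n:\sum_i x_i=k\}$. For $p\in(0,1)$, $\mu_p$ is the product measure on $\{0,1\}^n$ with $\mu_p(x)=p^{\sum_i x_i}(1-p)^{\sum_i(1-x_i)}$. Asymptotic notation refers to the limit $p(1-p)n\to\infty$ along the sequence. *)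

theory Defs
  imports "HOL-Probability.Probability" "HOL-Library.Landau_Symbols"
begin

text \<open>
  Points of the cube are 0/1-valued functions on \<open>{..<n}\<close>, extended by \<open>undefined\<close> outside,
  so that \<open>n\<close> can vary along a sequence.
\<close>

definition cube :: "nat \<Rightarrow> (nat \<Rightarrow> nat) set" where
  "cube n = {..<n} \<rightarrow>\<^sub>E {0, 1}"

definition slice :: "nat \<Rightarrow> nat \<Rightarrow> (nat \<Rightarrow> nat) set" where
  "slice n k = {x \<in> cube n. (\<Sum>i<n. x i) = k}"

definition slice_measure :: "nat \<Rightarrow> nat \<Rightarrow> (nat \<Rightarrow> nat) measure" where
  "slice_measure n k = uniform_count_measure (slice n k)"

text \<open>The truncated subtraction \<open>1 - x i\<close> is harmless because \<open>x i \<le> 1\<close> on the cube.\<close>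

definition cube_measure :: "nat \<Rightarrow> real \<Rightarrow> (nat \<Rightarrow> nat) measure" where
  "cube_measure n p =
     point_measure (cube n) (\<lambda>x. ennreal (p ^ (\<Sum>i<n. x i) * (1 - p) ^ (\<Sum>i<n. 1 - x i)))"

definition depends_on_at_most :: "nat \<Rightarrow> nat \<Rightarrow> ((nat \<Rightarrow> nat) \<Rightarrow> real) \<Rightarrow> bool" where
  "depends_on_at_most n m f \<longleftrightarrow>
     (\<exists>S \<subseteq> {..<n}. card S \<le> m \<and>
        (\<forall>x \<in> cube n. \<forall>y \<in> cube n. (\<forall>i \<in> S. x i = y i) \<longrightarrow> f x = f y))"

lemma finite_cube [simp]: "finite (cube n)"
  unfolding cube_def by (intro finite_PiE) auto

lemma prob_space_slice_measure:
  assumes "k \<le> n"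
  shows "prob_space (slice_measure n k)"
proof -
  define x where "x = restrict (\<lambda>i. if i < k then 1 else 0 :: nat) {..<n}"
  have "(\<Sum>i<n. x i) = (\<Sum>i<n. if i < k then 1 else 0)"
    by (intro sum.cong) (auto simp: x_def)
  also have "\<dots> = card ({..<n} \<inter> {i. i < k})"
    by (simp add: sum.If_cases)
  also have "{..<n} \<inter> {i. i < k} = {..<k}" using assms by auto
  finally have "x \<in> slice n k" by (auto simp: slice_def cube_def x_def)
  moreover have "finite (slice n k)" by (simp add: slice_def)
  ultimately show ?thesis
    unfolding slice_measure_def by (intro prob_space_uniform_count_measure) auto
qed

lemma prob_space_cube_measure:
  assumes "0 < p" "p < 1"
  shows "prob_space (cube_measure n p)"
proof -
  have "(\<Sum>x\<in>cube n. p ^ (\<Sum>i<n. x i) * (1 - p) ^ (\<Sum>i<n. 1 - x i))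
      = (\<Sum>x\<in>{..<n} \<rightarrow>\<^sub>E {0, 1::nat}. \<Prod>i<n. p ^ x i * (1 - p) ^ (1 - x i))"
    by (simp add: cube_def prod.distrib power_sum)
  also have "\<dots> = (\<Prod>i<n. \<Sum>b\<in>{0, 1::nat}. p ^ b * (1 - p) ^ (1 - b))"
    by (rule prod_sum_PiE [symmetric]) auto
  also have "\<dots> = 1" by simp
  finally have "emeasure (cube_measure n p) (cube n) = 1"
    using assms by (simp add: cube_measure_def emeasure_point_measure_finite sum_ennreal)
  then show ?thesis
    by (intro prob_spaceI) (simp add: cube_measure_def space_point_measure)
qed

end

theory Submission
  imports Defs
begin

text \<open>
  A function that depends only on the coordinates in \<open>S\<close> sees the two measures only through
  their marginals on \<open>S\<close>.  Under both measures the marginal probability of a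
  pattern \<open>y\<close> depends only on \<open>card S = j\<close> and on the number \<open>s\<close> of ones of \<open>y\<close>: it is
  \<open>(n - j choose k - s) / (n choose k)\<close> for the slice and \<open>p ^ s * (1 - p) ^ (j - s)\<close> for the cube.
  So the difference of the expectations is at most the \<open>L1\<close> distance of these two weights, and
  the task is to show that sampling without replacement is close to sampling with replacement
  as long as the sample is a small fraction of the population.

  Adding up the error made at each coordinate in total variation would only work when
  \<open>m\<^sup>3 * p * (1 - p) = o(n\<^sup>2)\<close>.  Relative entropy does better, because its chain rule adds up
  squares of the errors.  Reveal the coordinates of \<open>S\<close> one at a time.
  Given \<open>s\<close> ones among the first \<open>j\<close> coordinates, the next one is \<open>1\<close> with probability
  \<open>q = (k - s) / (n - j)\<close> on the slice and \<open>p\<close> on the cube, and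
  \<open>q - p = - (s - j * p) / (n - j)\<close>.  The relative entropy of the two Bernoulli laws is at most
  \<open>(q - p)\<^sup>2 / (p * (1 - p))\<close> (\<open>bernoulli_kl_le_chi2\<close>), and the variance of \<open>s\<close> is
  at most \<open>j * p * (1 - p)\<close> (\<open>slice_variance_le\<close>), so the step costs at most \<open>j / (n - j)\<^sup>2\<close>
  (\<open>slice_entropy_insert\<close>); the factor \<open>p * (1 - p)\<close> has cancelled.  The total relative entropy is
  at most \<open>(m / (n - m))\<^sup>2\<close> (\<open>slice_entropy_le\<close>), and a weak form of Pinsker's
  inequality (\<open>weak_pinsker\<close>) turns this into the explicit bound \<open>2 * m / (n - m)\<close>
  (\<open>slice_vs_cube\<close>).  It tends to \<open>0\<close> because \<open>m = o(p * (1 - p) * n)\<close> implies \<open>m = o(n)\<close>.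
\<close>

section \<open>Exchangeable weights on bit patterns\<close>

abbreviation bits :: "'a set \<Rightarrow> ('a \<Rightarrow> nat) set" where
  "bits S \<equiv> S \<rightarrow>\<^sub>E {0, 1}"

text \<open>
  \<open>w j s\<close> is meant as the probability of one particular pattern with \<open>s\<close> ones on \<open>j\<close> coordinates;
  the equation says that the weights on \<open>j\<close> coordinates are the marginals of those on \<open>j + 1\<close>.
\<close>

definition coherent :: "nat \<Rightarrow> (nat \<Rightarrow> nat \<Rightarrow> real) \<Rightarrow> bool" where
  "coherent n w \<longleftrightarrow> (\<forall>j<n. \<forall>s\<le>j. w j s = w (Suc j) s + w (Suc j) (Suc s))"

text \<open>
  A pattern with \<open>s\<close> ones on \<open>j\<close> coordinates extends to a point of the slice by choosing the places
  of the remaining \<open>k - s\<close> ones.  The guard is needed because \<open>k - s\<close> is truncated.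
\<close>

definition slice_weight :: "nat \<Rightarrow> nat \<Rightarrow> nat \<Rightarrow> nat \<Rightarrow> real" where
  "slice_weight n k j s =
     (if s \<le> k then real ((n - j) choose (k - s)) / real (n choose k) else 0)"

definition product_weight :: "real \<Rightarrow> nat \<Rightarrow> nat \<Rightarrow> real" where
  "product_weight p j s = p ^ s * (1 - p) ^ (j - s)"

lemma sum_bits_le_card:
  assumes "x \<in> bits S" "finite S"
  shows "sum x S \<le> card S"
proof -
  have "sum x S \<le> (\<Sum>i\<in>S. 1)"
    using assms by (intro sum_mono) (force simp: PiE_iff)
  then show ?thesis by simp
qed

lemma sum_bits_insert:
  assumes "i \<notin> S" "finite S"
  shows "(\<Sum>x\<in>bits (insert i S). g x) = (\<Sum>x\<in>bits S. g (x(i := 0)) + g (x(i := 1)))"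
proof -
  have "(\<Sum>x\<in>bits (insert i S). g x)
      = (\<Sum>(b, x)\<in>{0, 1} \<times> bits S. g (x(i := b)))"
    unfolding PiE_insert_eq
    by (subst sum.reindex[OF inj_combinator[OF assms(1)]]) (simp add: case_prod_unfold)
  also have "\<dots> = (\<Sum>b\<in>{0, 1}. \<Sum>x\<in>bits S. g (x(i := b)))"
    by (rule sum.cartesian_product [symmetric])
  finally show ?thesis by (simp add: sum.distrib)
qed

lemma sum_fun_upd_notin: "i \<notin> S \<Longrightarrow> sum (x(i := b)) S = sum x S"
  by (intro sum.cong) auto

lemma sum_fun_upd_insert:
  fixes x :: "'a \<Rightarrow> nat"
  assumes "i \<notin> S" "finite S"
  shows "sum (x(i := b)) (insert i S) = b + sum x S"
  using assms by (simp add: sum_fun_upd_notin del: fun_upd_apply) simp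

lemma sum_bits_weight_insert:
  assumes "i \<notin> S" "finite S"
  shows "(\<Sum>x\<in>bits (insert i S). G (sum x (insert i S)))
       = (\<Sum>x\<in>bits S. G (sum x S) + G (Suc (sum x S)))"
  unfolding sum_bits_insert[OF assms] sum_fun_upd_insert[OF assms] by simp

text \<open>
  Summing out the coordinates in \<open>T\<close> one at a time, each step being one instance of coherence.
  This treats the slice and the cube at once, and the number of points of the slice that extend
  a given pattern comes out without a separate count.
\<close>

lemma marginal_of_coherent:
  assumes w: "coherent n w" and fin: "finite T" "finite S"
    and "S \<inter> T = {}" "card (S \<union> T) \<le> n"
  shows "(\<Sum>x\<in>bits (S \<union> T). F (restrict x S) * w (card (S \<union> T)) (sum x (S \<union> T)))
       = (\<Sum>y\<in>bits S. F y * w (card S) (sum y S))"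
  using fin(1) assms(4,5)
proof (induction T rule: finite_induct)
  case empty
  show ?case by (intro sum.cong) auto
next
  case (insert i T)
  let ?U = "S \<union> T"
  have i: "i \<notin> ?U" and U: "finite ?U" using insert fin by auto
  have c: "card (insert i ?U) = Suc (card ?U)" using i U by simp
  have eq: "S \<union> insert i T = insert i ?U" by simp
  have r: "restrict (x(i := b)) S = restrict x S" for x and b :: nat
    using i by (auto simp: restrict_def fun_eq_iff)
  have "(\<Sum>x\<in>bits (insert i ?U). F (restrict x S) * w (card (insert i ?U)) (sum x (insert i ?U)))
     = (\<Sum>x\<in>bits ?U. F (restrict x S) * (w (Suc (card ?U)) (sum x ?U)
                                              + w (Suc (card ?U)) (Suc (sum x ?U))))"
    unfolding sum_bits_insert[OF i U] c sum_fun_upd_insert[OF i U] r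
    by (simp add: distrib_left)
  also have "\<dots> = (\<Sum>x\<in>bits ?U. F (restrict x S) * w (card ?U) (sum x ?U))"
  proof (intro sum.cong refl)
    fix x assume "x \<in> bits ?U"
    then have "sum x ?U \<le> card ?U" using U by (rule sum_bits_le_card)
    moreover have "card ?U < n" using insert.prems c eq by simp
    ultimately show "F (restrict x S) * (w (Suc (card ?U)) (sum x ?U)
                                              + w (Suc (card ?U)) (Suc (sum x ?U)))
        = F (restrict x S) * w (card ?U) (sum x ?U)"
      using w by (simp add: coherent_def)
  qed
  also have "\<dots> = (\<Sum>y\<in>bits S. F y * w (card S) (sum y S))"
    using insert.prems c eq by (intro insert.IH) auto
  finally show ?case unfolding eq .
qed

text \<open>Pascal's rule is the coherence of the slice weights.\<close>

lemma slice_weight_split: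
  assumes "j < n"
  shows "slice_weight n k j s = slice_weight n k (Suc j) s + slice_weight n k (Suc j) (Suc s)"
proof (cases "s < k")
  case True
  then have k: "k - s = Suc (k - Suc s)" by simp
  have n: "n - j = Suc (n - Suc j)" using assms by simp
  show ?thesis using True unfolding slice_weight_def n k
    by (simp add: add_divide_distrib)
qed (auto simp: slice_weight_def)

lemma coherent_slice_weight: "coherent n (slice_weight n k)"
  unfolding coherent_def using slice_weight_split by blast

lemma coherent_product_weight: "coherent n (product_weight p)"
  by (auto simp: coherent_def product_weight_def Suc_diff_le algebra_simps)

section \<open>Revealing one more coordinate of the slice\<close>

lemma slice_weight_nonneg: "slice_weight n k j s \<ge> 0"
  by (simp add: slice_weight_def)

text \<open>
  Given \<open>s\<close> ones among \<open>j\<close> revealed coordinates, \<open>k - s\<close> ones are left for \<open>n - j\<close> places, so the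
  next coordinate is \<open>1\<close> with probability \<open>(k - s) / (n - j)\<close>.  With real subtraction the identities
  also hold for patterns of probability \<open>0\<close>, where that quotient need not lie in \<open>[0, 1]\<close>.
\<close>

lemma slice_weight_Suc:
  assumes "j < n"
  shows "slice_weight n k (Suc j) (Suc s)
           = slice_weight n k j s * ((real k - real s) / (real n - real j))"
    and "slice_weight n k (Suc j) s
           = slice_weight n k j s * (1 - (real k - real s) / (real n - real j))"
proof -
  have n: "n - j = Suc (n - Suc j)" using assms by simp
  have r: "real (n - j) = real n - real j" "real n - real j > 0" using assms by auto
  have "slice_weight n k (Suc j) (Suc s) * (real n - real j)
           = slice_weight n k j s * (real k - real s)"
  proof (cases "s < k")
    case True
    then have k: "k - s = Suc (k - Suc s)" by simp
    have "real (n - j) * real ((n - Suc j) choose (k - Suc s))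
        = real ((n - j) choose (k - s)) * real (k - s)"
      using Suc_times_binomial_eq[of "n - Suc j" "k - Suc s"] unfolding n k
      by (metis of_nat_mult)
    then have "real ((n - Suc j) choose (k - Suc s)) * (real n - real j)
        = real ((n - j) choose (k - s)) * (real k - real s)"
      using True by (simp only: r(1) of_nat_diff less_imp_le mult.commute)
    then show ?thesis
      using True by (simp add: slice_weight_def)
  qed (auto simp: slice_weight_def)
  then show first: "slice_weight n k (Suc j) (Suc s)
           = slice_weight n k j s * ((real k - real s) / (real n - real j))"
    using r by (simp add: field_simps)
  show "slice_weight n k (Suc j) s
           = slice_weight n k j s * (1 - (real k - real s) / (real n - real j))"
    using slice_weight_split[OF assms, of k s] unfolding first by (simp add: algebra_simps)
qed

lemma slice_conditional_prob:
  assumes "j < n" "slice_weight n k j s \<noteq> 0"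
  shows "0 \<le> (real k - real s) / (real n - real j)" "(real k - real s) / (real n - real j) \<le> 1"
proof -
  have "s \<le> k" "(n - j) choose (k - s) \<noteq> 0"
    using assms(2) by (auto simp: slice_weight_def split: if_splits)
  then have "k - s \<le> n - j" by (metis binomial_eq_0 not_le)
  then have "real k - real s \<le> real n - real j" using \<open>s \<le> k\<close> assms(1) by linarith
  then show "0 \<le> (real k - real s) / (real n - real j)" "(real k - real s) / (real n - real j) \<le> 1"
    using \<open>s \<le> k\<close> assms(1) divide_le_eq_1_pos[of "real n - real j"] by simp_all
qed

lemma slice_weight_0:
  assumes "k \<le> n" shows "slice_weight n k 0 0 = 1"
  using assms by (simp add: slice_weight_def)

lemma slice_weight_n: "slice_weight n k n s = (if s = k then 1 / real (n choose k) else 0)"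
  by (auto simp: slice_weight_def)

lemma sum_weights_eq_1:
  assumes "coherent n w" "w 0 0 = 1" "finite S" "card S \<le> n"
  shows "(\<Sum>y\<in>bits S. w (card S) (sum y S)) = 1"
  using marginal_of_coherent[of n w S "{}" "\<lambda>_. 1"] assms by simp

section \<open>Mean and variance of the number of ones\<close>

text \<open>
  With \<open>r = n - j\<close>, the deviation \<open>t = s - j * p\<close> changes on average by \<open>q - p = - t / r\<close>, so
  its expectation is multiplied by \<open>1 - 1 / r\<close> at every step and stays \<open>0\<close>.
\<close>

lemma slice_mean:
  fixes S :: "'a set"
  assumes "finite S" "card S \<le> n" "real k = p * real n"
  shows "(\<Sum>y\<in>bits S. slice_weight n k (card S) (sum y S) * (real (sum y S) - real (card S) * p)) = 0"
  using assms(1,2)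
proof (induction S rule: finite_induct)
  case (insert i S)
  let ?j = "card S" and ?w = "\<lambda>y. slice_weight n k (card S) (sum y S)"
  have j: "?j < n" using insert by simp
  define r where "r = real n - real ?j"
  have r: "r > 0" using j by (simp add: r_def)
  have "(\<Sum>y\<in>bits (insert i S). slice_weight n k (card (insert i S)) (sum y (insert i S))
           * (real (sum y (insert i S)) - real (card (insert i S)) * p))
      = (\<Sum>y\<in>bits S. ?w y * (real (sum y S) - real ?j * p) * (1 - 1 / r))"
    unfolding sum_bits_weight_insert[OF insert.hyps(2,1),
        where G = "\<lambda>s. slice_weight n k (card (insert i S)) s * (real s - real (card (insert i S)) * p)"]
  proof (intro sum.cong refl)
    fix y :: "'a \<Rightarrow> nat"
    let ?s = "sum y S"
    define q where "q = (real k - real ?s) / r"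
    have q: "q = p - (real ?s - real ?j * p) / r"
      using r assms(3) by (simp add: q_def field_simps) (simp add: r_def algebra_simps)
    have "slice_weight n k (Suc ?j) ?s * (real ?s - real (Suc ?j) * p)
       + slice_weight n k (Suc ?j) (Suc ?s) * (real (Suc ?s) - real (Suc ?j) * p)
      = ?w y * ((1 - q) * (real ?s - real (Suc ?j) * p) + q * (real (Suc ?s) - real (Suc ?j) * p))"
      unfolding slice_weight_Suc[OF j, of k ?s] q_def r_def by (simp only: distrib_left mult.assoc)
    also have "(1 - q) * (real ?s - real (Suc ?j) * p) + q * (real (Suc ?s) - real (Suc ?j) * p)
       = (real ?s - real ?j * p) + (q - p)" by (simp add: algebra_simps del: of_nat_sum)
    also have "\<dots> = (real ?s - real ?j * p) * (1 - 1 / r)"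
      unfolding q by (simp add: right_diff_distrib del: of_nat_sum)
    finally show "slice_weight n k (card (insert i S)) ?s * (real ?s - real (card (insert i S)) * p)
       + slice_weight n k (card (insert i S)) (Suc ?s) * (real (Suc ?s) - real (card (insert i S)) * p)
       = ?w y * (real ?s - real ?j * p) * (1 - 1 / r)"
      using insert.hyps by (simp add: mult.assoc)
  qed
  also have "\<dots> = 0"
    unfolding sum_distrib_right [symmetric] using insert by simp
  finally show ?case .
qed simp

text \<open>
  The conditional second moment of the deviation after one more coordinate, which
  adds \<open>1 - p\<close> to \<open>t\<close> with probability \<open>q\<close> and \<open>- p\<close> otherwise.  On the right, the term linear
  in \<open>t\<close> has mean \<open>0\<close>.
\<close>

lemma second_moment_step:
  fixes p q r t :: real
  assumes "q = p - t / r"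
  shows "(1 - q) * (t - p)\<^sup>2 + q * (t + 1 - p)\<^sup>2
       = (1 - 2 / r) * t\<^sup>2 - (1 - 2 * p) / r * t + p * (1 - p)"
proof -
  define d where "d = t / r"
  have "(1 - q) * (t - p)\<^sup>2 + q * (t + 1 - p)\<^sup>2 = t\<^sup>2 - 2 * t * d - (1 - 2 * p) * d + p * (1 - p)"
    unfolding assms d_def [symmetric] by (simp add: algebra_simps power2_eq_square)
  also have "\<dots> = (1 - 2 / r) * t\<^sup>2 - (1 - 2 * p) / r * t + p * (1 - p)"
    unfolding d_def by (simp add: algebra_simps power2_eq_square diff_divide_distrib)
  finally show ?thesis .
qed

text \<open>
  By \<open>second_moment_step\<close> and the vanishing mean, the variance \<open>V\<close> becomes
  \<open>(1 - 2 / r) * V + p * (1 - p)\<close> after one more coordinate; the negative correlation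
  only helps, and dropping it leaves the binomial variance.
\<close>

lemma slice_variance_le:
  fixes S :: "'a set"
  assumes "finite S" "card S \<le> n" "k \<le> n" "real k = p * real n"
  shows "(\<Sum>y\<in>bits S. slice_weight n k (card S) (sum y S) * (real (sum y S) - real (card S) * p)\<^sup>2)
         \<le> real (card S) * (p * (1 - p))"
  using assms(1,2)
proof (induction S rule: finite_induct)
  case (insert i S)
  let ?j = "card S" and ?w = "\<lambda>y. slice_weight n k (card S) (sum y S)"
  have j: "?j < n" using insert by simp
  define r where "r = real n - real ?j"
  have r: "r > 0" using j by (simp add: r_def)
  let ?t = "\<lambda>y. real (sum y S) - real ?j * p"
  let ?V = "\<Sum>y\<in>bits S. ?w y * (?t y)\<^sup>2"
  have "(\<Sum>y\<in>bits (insert i S). slice_weight n k (card (insert i S)) (sum y (insert i S))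
           * (real (sum y (insert i S)) - real (card (insert i S)) * p)\<^sup>2)
      = (\<Sum>y\<in>bits S. (1 - 2 / r) * (?w y * (?t y)\<^sup>2) - (1 - 2 * p) / r * (?w y * ?t y)
            + p * (1 - p) * ?w y)"
    unfolding sum_bits_weight_insert[OF insert.hyps(2,1),
        where G = "\<lambda>s. slice_weight n k (card (insert i S)) s * (real s - real (card (insert i S)) * p)\<^sup>2"]
  proof (intro sum.cong refl)
    fix y :: "'a \<Rightarrow> nat"
    let ?s = "sum y S"
    define q where "q = (real k - real ?s) / r"
    have q: "q = p - ?t y / r"
      using r assms(4) by (simp add: q_def field_simps) (simp add: r_def algebra_simps)
    have "slice_weight n k (Suc ?j) ?s * (real ?s - real (Suc ?j) * p)\<^sup>2
       + slice_weight n k (Suc ?j) (Suc ?s) * (real (Suc ?s) - real (Suc ?j) * p)\<^sup>2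
      = ?w y * ((1 - q) * (real ?s - real (Suc ?j) * p)\<^sup>2 + q * (real (Suc ?s) - real (Suc ?j) * p)\<^sup>2)"
      unfolding slice_weight_Suc[OF j, of k ?s] q_def r_def by (simp only: distrib_left mult.assoc)
    also have "(1 - q) * (real ?s - real (Suc ?j) * p)\<^sup>2 + q * (real (Suc ?s) - real (Suc ?j) * p)\<^sup>2
       = (1 - q) * (?t y - p)\<^sup>2 + q * (?t y + 1 - p)\<^sup>2"
      by (simp add: distrib_right diff_diff_eq add.commute add_diff_eq del: of_nat_sum)
    also have "\<dots> = (1 - 2 / r) * (?t y)\<^sup>2 - (1 - 2 * p) / r * ?t y + p * (1 - p)"
      using q by (rule second_moment_step)
    also have "?w y * \<dots> = (1 - 2 / r) * (?w y * (?t y)\<^sup>2) - (1 - 2 * p) / r * (?w y * ?t y)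
            + p * (1 - p) * ?w y" by (simp only: distrib_left right_diff_distrib mult_ac)
    finally show "slice_weight n k (card (insert i S)) ?s * (real ?s - real (card (insert i S)) * p)\<^sup>2
       + slice_weight n k (card (insert i S)) (Suc ?s) * (real (Suc ?s) - real (card (insert i S)) * p)\<^sup>2
       = (1 - 2 / r) * (?w y * (?t y)\<^sup>2) - (1 - 2 * p) / r * (?w y * ?t y) + p * (1 - p) * ?w y"
      using insert.hyps by simp
  qed
  also have "\<dots> = (1 - 2 / r) * ?V - (1 - 2 * p) / r * (\<Sum>y\<in>bits S. ?w y * ?t y)
            + p * (1 - p) * (\<Sum>y\<in>bits S. ?w y)"
    by (simp only: sum.distrib sum_subtractf sum_distrib_left)
  also have "(\<Sum>y\<in>bits S. ?w y * ?t y) = 0"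
    using insert j by (intro slice_mean assms) auto
  also have "(\<Sum>y\<in>bits S. ?w y) = 1"
    using insert j assms by (intro sum_weights_eq_1[OF coherent_slice_weight] slice_weight_0) auto
  also have "(1 - 2 / r) * ?V - (1 - 2 * p) / r * 0 + p * (1 - p) * 1 \<le> ?V + p * (1 - p)"
  proof -
    have "?V \<ge> 0" by (intro sum_nonneg mult_nonneg_nonneg slice_weight_nonneg) auto
    then show ?thesis using r by (simp add: left_diff_distrib)
  qed
  also have "\<dots> \<le> real ?j * (p * (1 - p)) + p * (1 - p)" using insert by simp
  finally show ?case using insert.hyps by (simp add: distrib_right)
qed simp

section \<open>Relative entropy of the slice with respect to the product measure\<close>

text \<open>Apply \<open>ln z \<le> z - 1\<close> to both logarithms; the resulting sum is exactly the right-hand side.\<close>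

lemma bernoulli_kl_le_chi2:
  fixes p q :: real
  assumes "0 < p" "p < 1" "0 \<le> q" "q \<le> 1"
  shows "q * ln (q / p) + (1 - q) * ln ((1 - q) / (1 - p)) \<le> (q - p)\<^sup>2 / (p * (1 - p))"
proof -
  have le: "a * ln (a / b) \<le> a * (a / b - 1)" if "a \<ge> 0" "b > 0" for a b :: real
    using that ln_le_minus_one[of "a / b"] by (cases "a = 0") (auto intro!: mult_left_mono)
  have "q * ln (q / p) + (1 - q) * ln ((1 - q) / (1 - p))
      \<le> q * (q / p - 1) + (1 - q) * ((1 - q) / (1 - p) - 1)"
    using assms by (intro add_mono le) auto
  also have "\<dots> = (q - p)\<^sup>2 / (p * (1 - p))"
    using assms by (simp add: field_simps power2_eq_square)
  finally show ?thesis .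
qed

text \<open>
  The chain rule for one pattern: \<open>a\<close>, \<open>b\<close> are its weights and \<open>u\<close>, \<open>v\<close> the conditional
  probabilities of the next bit.  The prefactors make it true also when \<open>a\<close> or \<open>u\<close> vanishes.
\<close>

lemma mult_ln_split:
  fixes a b u v :: real
  assumes "a \<ge> 0" "b > 0" "u \<ge> 0" "v > 0"
  shows "a * u * ln (a * u / (b * v)) = a * u * ln (a / b) + a * (u * ln (u / v))"
proof (cases "a = 0 \<or> u = 0")
  case False
  then have "ln (a * u / (b * v)) = ln (a / b) + ln (u / v)"
    using assms by (subst ln_mult_pos [symmetric]) auto
  then show ?thesis by (simp add: algebra_simps)
qed auto

text \<open>
  Relative entropy (Kullback--Leibler divergence) of the marginal on \<open>S\<close> of the uniform measure on
  the slice, with respect to the product measure.  Patterns outside the support of the former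
  contribute \<open>0\<close> because the logarithm has a vanishing factor.
\<close>

definition slice_entropy :: "nat \<Rightarrow> nat \<Rightarrow> real \<Rightarrow> 'a set \<Rightarrow> real" where
  "slice_entropy n k p S = (\<Sum>y\<in>bits S. slice_weight n k (card S) (sum y S)
     * ln (slice_weight n k (card S) (sum y S) / product_weight p (card S) (sum y S)))"

text \<open>
  By the chain rule the increment is the average over the slice of the relative entropy of the
  conditional Bernoulli laws.  It is at most the variance of the number of ones divided by
  \<open>(n - j)\<^sup>2 * p * (1 - p)\<close>.
\<close>

lemma slice_entropy_insert:
  assumes "finite S" "i \<notin> S" "card S < n" "k \<le> n" "real k = p * real n" "0 < p" "p < 1"
  shows "slice_entropy n k p (insert i S)
       \<le> slice_entropy n k p S + real (card S) / (real n - real (card S))\<^sup>2"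
proof -
  let ?j = "card S"
  let ?w = "\<lambda>y. slice_weight n k ?j (sum y S)" and ?v = "\<lambda>y. product_weight p ?j (sum y S)"
  let ?t = "\<lambda>y. real (sum y S) - real ?j * p"
  define r where "r = real n - real ?j"
  have r: "r > 0" using assms by (simp add: r_def)
  let ?g = "\<lambda>s. slice_weight n k (Suc ?j) s * ln (slice_weight n k (Suc ?j) s / product_weight p (Suc ?j) s)"
  have "slice_entropy n k p (insert i S) = (\<Sum>y\<in>bits S. ?g (sum y S) + ?g (Suc (sum y S)))"
    unfolding slice_entropy_def
    using sum_bits_weight_insert[OF assms(2,1), where G = ?g] assms by simp
  also have "\<dots> \<le> (\<Sum>y\<in>bits S. ?w y * ln (?w y / ?v y) + ?w y * (?t y)\<^sup>2 * (1 / (r\<^sup>2 * (p * (1 - p)))))"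
  proof (intro sum_mono)
    fix y assume "y \<in> bits S"
    then have s: "sum y S \<le> ?j" using assms(1) by (rule sum_bits_le_card)
    let ?s = "sum y S"
    define q where "q = (real k - real ?s) / r"
    have q: "q - p = - (?t y / r)"
      using r assms(5) by (simp add: q_def field_simps) (simp add: r_def algebra_simps)
    have v: "?v y > 0" "product_weight p (Suc ?j) (Suc ?s) = ?v y * p"
       "product_weight p (Suc ?j) ?s = ?v y * (1 - p)"
      using assms s by (auto simp: product_weight_def Suc_diff_le)
    show "?g ?s + ?g (Suc ?s)
       \<le> ?w y * ln (?w y / ?v y) + ?w y * (?t y)\<^sup>2 * (1 / (r\<^sup>2 * (p * (1 - p))))"
    proof (cases "?w y = 0")
      case True
      then show ?thesis using slice_weight_Suc[OF assms(3), of k ?s] by simp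
    next
      case False
      have q01: "0 \<le> q" "q \<le> 1"
        using slice_conditional_prob[OF assms(3) False] by (auto simp: q_def r_def)
      have "?g (Suc ?s) = ?w y * q * ln (?w y * q / (?v y * p))"
        unfolding v slice_weight_Suc(1)[OF assms(3)] q_def r_def ..
      also have "\<dots> = ?w y * q * ln (?w y / ?v y) + ?w y * (q * ln (q / p))"
        using v q01 assms by (intro mult_ln_split slice_weight_nonneg) auto
      finally have 1: "?g (Suc ?s) = ?w y * q * ln (?w y / ?v y) + ?w y * (q * ln (q / p))" .
      have "?g ?s = ?w y * (1 - q) * ln (?w y * (1 - q) / (?v y * (1 - p)))"
        unfolding v slice_weight_Suc(2)[OF assms(3)] q_def r_def ..
      also have "\<dots> = ?w y * (1 - q) * ln (?w y / ?v y) + ?w y * ((1 - q) * ln ((1 - q) / (1 - p)))"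
        using v q01 assms by (intro mult_ln_split slice_weight_nonneg) auto
      finally have "?g ?s + ?g (Suc ?s) = ?w y * ln (?w y / ?v y)
           + ?w y * (q * ln (q / p) + (1 - q) * ln ((1 - q) / (1 - p)))"
        unfolding 1 by (simp add: algebra_simps)
      also have "\<dots> \<le> ?w y * ln (?w y / ?v y) + ?w y * ((q - p)\<^sup>2 / (p * (1 - p)))"
        using assms q01 by (intro add_left_mono mult_left_mono bernoulli_kl_le_chi2 slice_weight_nonneg)
      also have "(q - p)\<^sup>2 / (p * (1 - p)) = (?t y)\<^sup>2 * (1 / (r\<^sup>2 * (p * (1 - p))))"
        unfolding q by (simp add: power_divide)
      finally show ?thesis by (simp only: mult.assoc)
    qed
  qed
  also have "\<dots> = slice_entropy n k p S + (\<Sum>y\<in>bits S. ?w y * (?t y)\<^sup>2) * (1 / (r\<^sup>2 * (p * (1 - p))))"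
    unfolding slice_entropy_def by (simp only: sum.distrib sum_distrib_right)
  also have "\<dots> \<le> slice_entropy n k p S + (real ?j * (p * (1 - p))) * (1 / (r\<^sup>2 * (p * (1 - p))))"
    using assms by (intro add_left_mono mult_right_mono slice_variance_le) auto
  also have "(real ?j * (p * (1 - p))) * (1 / (r\<^sup>2 * (p * (1 - p)))) = real ?j / r\<^sup>2"
    using assms by simp
  finally show ?thesis unfolding r_def .
qed

text \<open>
  Summing \<open>j / (n - j)\<^sup>2\<close> over the steps.  The square on the right is a closed form that
  absorbs one step: \<open>j\<^sup>2 + j \<le> (j + 1)\<^sup>2\<close>, while the denominator only decreases.
\<close>

lemma slice_entropy_le:
  assumes "finite S" "card S < n" "k \<le> n" "real k = p * real n" "0 < p" "p < 1"
  shows "slice_entropy n k p S \<le> (real (card S) / (real n - real (card S)))\<^sup>2"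
  using assms(1,2)
proof (induction S rule: finite_induct)
  case empty
  then show ?case using assms by (simp add: slice_entropy_def slice_weight_0 product_weight_def)
next
  case (insert i S)
  let ?j = "real (card S)" and ?r = "real n - real (card S)"
  have r: "?r > 1" "card S < n" using insert by auto
  have "slice_entropy n k p (insert i S) \<le> slice_entropy n k p S + ?j / ?r\<^sup>2"
    using insert r by (intro slice_entropy_insert assms) auto
  also have "\<dots> \<le> (?j / ?r)\<^sup>2 + ?j / ?r\<^sup>2" using insert r by simp
  also have "\<dots> = (?j\<^sup>2 + ?j) / ?r\<^sup>2" by (simp add: power_divide add_divide_distrib)
  also have "\<dots> \<le> (?j + 1)\<^sup>2 / (?r - 1)\<^sup>2"
  proof (rule frac_le)
    show "?j\<^sup>2 + ?j \<le> (?j + 1)\<^sup>2" by (simp add: power2_sum)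
    have "?r - 1 > 0" using insert.prems insert.hyps by simp
    then show "(?r - 1)\<^sup>2 > 0" "(?r - 1)\<^sup>2 \<le> ?r\<^sup>2" by (auto intro!: power_mono)
  qed auto
  finally show ?case using insert.hyps by (simp add: power_divide algebra_simps)
qed

text \<open>
  Pinsker's inequality with a worse constant, by way of the Hellinger distance:
  \<open>\<bar>a - b\<bar> = \<bar>sqrt a - sqrt b\<bar> * (sqrt a + sqrt b)\<close>, and after Cauchy--Schwarz the first factor is bounded
  by the relative entropy and the second by \<open>2 * (1 + 1)\<close>.
\<close>

lemma weak_pinsker:
  fixes a b :: "'a \<Rightarrow> real"
  assumes "\<And>x. x \<in> I \<Longrightarrow> a x \<ge> 0" "\<And>x. x \<in> I \<Longrightarrow> b x > 0" "sum a I = 1" "sum b I = 1"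
  shows "(\<Sum>x\<in>I. \<bar>a x - b x\<bar>)\<^sup>2 \<le> 4 * (\<Sum>x\<in>I. a x * ln (a x / b x))"
proof -
  \<comment> \<open>Write \<open>ln (v / u)\<close> as \<open>2 * ln (sqrt (v / u))\<close> and use \<open>ln z \<le> z - 1\<close>.  The terms
      \<open>- u + v\<close>, which cancel in the sum, make the bound hold for each summand.\<close>
  have hellinger: "(sqrt u - sqrt v)\<^sup>2 \<le> u * ln (u / v) - u + v" if "u \<ge> 0" "v > 0" for u v :: real
  proof (cases "u = 0")
    case False
    then have u: "u > 0" using that by simp
    have "ln (v / u) = 2 * ln (sqrt (v / u))" using u that by (simp add: ln_sqrt)
    also have "\<dots> \<le> 2 * (sqrt (v / u) - 1)" using u that ln_le_minus_one[of "sqrt (v / u)"] by simp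
    finally have "u * ln (v / u) \<le> u * (2 * (sqrt (v / u) - 1))" using u by simp
    also have "u * (2 * (sqrt (v / u) - 1)) = 2 * (sqrt u * sqrt v) - 2 * u"
    proof -
      have "u * sqrt (v / u) = sqrt u * sqrt v"
        using u real_sqrt_mult_self[of u] by (simp add: real_sqrt_divide field_simps)
      then show ?thesis by (simp add: algebra_simps)
    qed
    finally have "u * ln (v / u) \<le> 2 * (sqrt u * sqrt v) - 2 * u" .
    moreover have "ln (v / u) = - ln (u / v)" using u that by (simp add: ln_div)
    ultimately show ?thesis using u that by (simp add: power2_diff)
  qed (use that in simp)
  have "(\<Sum>x\<in>I. \<bar>a x - b x\<bar>)\<^sup>2
      = (\<Sum>x\<in>I. \<bar>sqrt (a x) - sqrt (b x)\<bar> * (sqrt (a x) + sqrt (b x)))\<^sup>2"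
  proof (intro arg_cong[where f = "\<lambda>z. z\<^sup>2"] sum.cong refl)
    fix x assume "x \<in> I"
    then have ab: "a x \<ge> 0" "b x \<ge> 0" using assms(1,2) less_imp_le by blast+
    then have "a x - b x = (sqrt (a x) - sqrt (b x)) * (sqrt (a x) + sqrt (b x))"
      by (simp add: algebra_simps)
    then show "\<bar>a x - b x\<bar> = \<bar>sqrt (a x) - sqrt (b x)\<bar> * (sqrt (a x) + sqrt (b x))"
      using ab by (simp add: abs_mult)
  qed
  also have "\<dots> \<le> (\<Sum>x\<in>I. \<bar>sqrt (a x) - sqrt (b x)\<bar>\<^sup>2) * (\<Sum>x\<in>I. (sqrt (a x) + sqrt (b x))\<^sup>2)"
    by (rule Cauchy_Schwarz_ineq_sum)
  also have "\<dots> \<le> (\<Sum>x\<in>I. a x * ln (a x / b x) - a x + b x) * (\<Sum>x\<in>I. 2 * a x + 2 * b x)"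
  proof (intro mult_mono sum_mono sum_nonneg)
    fix x assume x: "x \<in> I"
    then have ab: "a x \<ge> 0" "b x > 0" using assms(1,2) by auto
    show h: "\<bar>sqrt (a x) - sqrt (b x)\<bar>\<^sup>2 \<le> a x * ln (a x / b x) - a x + b x"
      using hellinger[OF ab] by simp
    show "0 \<le> a x * ln (a x / b x) - a x + b x" using h zero_le_power2 order_trans by blast
    have "(sqrt (a x) + sqrt (b x))\<^sup>2 + (sqrt (a x) - sqrt (b x))\<^sup>2 = 2 * a x + 2 * b x"
      using ab by (simp add: power2_sum power2_diff)
    then show "(sqrt (a x) + sqrt (b x))\<^sup>2 \<le> 2 * a x + 2 * b x"
      using zero_le_power2[of "sqrt (a x) - sqrt (b x)"] by linarith
  qed auto
  also have "\<dots> = 4 * (\<Sum>x\<in>I. a x * ln (a x / b x))"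
    using assms(3,4) by (simp add: sum.distrib sum_subtractf flip: sum_distrib_left)
  finally show ?thesis .
qed

section \<open>Comparing the two expectations\<close>

text \<open>
  That the slice has \<open>n choose k\<close> points is the statement that the slice weights have total mass \<open>1\<close>.
\<close>

lemma integral_slice_measure:
  assumes "k \<le> n"
  shows "(\<integral>x. f x \<partial>slice_measure n k)
       = (\<Sum>x\<in>cube n. f x * slice_weight n k (card {..<n}) (sum x {..<n}))"
proof -
  have "(\<Sum>y\<in>bits {..<n}. slice_weight n k (card {..<n}) (sum y {..<n})) = 1"
    using assms by (intro sum_weights_eq_1[OF coherent_slice_weight] slice_weight_0) auto
  then have "(\<Sum>y\<in>cube n. if sum y {..<n} = k then 1 / real (n choose k) else 0) = 1"
    unfolding cube_def card_lessThan slice_weight_n .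
  moreover have "(\<Sum>y\<in>cube n. if sum y {..<n} = k then 1 / real (n choose k) else 0)
      = (\<Sum>y\<in>slice n k. 1 / real (n choose k))"
    unfolding slice_def by (rule sum.inter_filter [symmetric]) simp
  ultimately have "real (card (slice n k)) / real (n choose k) = 1"
    by (simp only: sum_constant times_divide_eq_right mult_1_right)
  then have card: "real (card (slice n k)) = real (n choose k)"
    by (simp only: divide_eq_1_iff)
  have fin: "finite (slice n k)" by (simp add: slice_def)
  have "(\<integral>x. f x \<partial>slice_measure n k) = (\<Sum>x\<in>slice n k. f x) / real (n choose k)"
    unfolding slice_measure_def
    by (simp add: uniform_count_measure_def lebesgue_integral_point_measure_finite fin card
        flip: sum_divide_distrib)
  also have "\<dots> = (\<Sum>x\<in>cube n. if sum x {..<n} = k then f x / real (n choose k) else 0)"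
    by (simp add: sum.inter_filter[symmetric] slice_def sum_divide_distrib)
  finally show ?thesis by (auto simp: slice_weight_n intro!: sum.cong)
qed

lemma integral_cube_measure:
  assumes "0 < p" "p < 1"
  shows "(\<integral>x. f x \<partial>cube_measure n p)
       = (\<Sum>x\<in>cube n. f x * product_weight p (card {..<n}) (sum x {..<n}))"
proof -
  have "(\<Sum>i<n. 1 - x i) = n - sum x {..<n}" if "x \<in> cube n" for x
  proof -
    have "x i \<le> 1" if "i < n" for i
      using \<open>x \<in> cube n\<close> that by (force simp: cube_def PiE_iff)
    then show ?thesis by (subst sum_subtractf_nat) auto
  qed
  then show ?thesis
    unfolding cube_measure_def using assms
    by (subst lebesgue_integral_point_measure_finite)
       (auto simp: product_weight_def mult_ac intro!: sum.cong)
qed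

text \<open>The quantitative form of the theorem, for a single \<open>n\<close>.\<close>

lemma slice_vs_cube:
  assumes k: "real k = p * real n" and p: "0 < p" "p < 1"
    and f: "\<And>x. x \<in> cube n \<Longrightarrow> \<bar>f x\<bar> \<le> 1"
    and dep: "depends_on_at_most n m f" and m: "m < n"
  shows "\<bar>(\<integral>x. f x \<partial>slice_measure n k) - (\<integral>x. f x \<partial>cube_measure n p)\<bar>
         \<le> 2 * (real m / (real n - real m))"
proof -
  obtain S where S: "S \<subseteq> {..<n}" "card S \<le> m"
    and eq: "\<And>x y. x \<in> cube n \<Longrightarrow> y \<in> cube n \<Longrightarrow> (\<forall>i\<in>S. x i = y i) \<Longrightarrow> f x = f y"
    using dep unfolding depends_on_at_most_def by blast
  have fin: "finite S" using S(1) finite_subset by blast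
  have kn: "k \<le> n"
  proof -
    have "p * real n \<le> 1 * real n" using p by (intro mult_right_mono) auto
    then show ?thesis using k by simp
  qed
  \<comment> \<open>Padding a pattern on \<open>S\<close> with zeros picks a point of the cube at which \<open>f\<close> takes the value
      that the pattern determines.\<close>
  define ext where "ext = (\<lambda>y. \<lambda>i\<in>{..<n}. if i \<in> S then y i else (0 :: nat))"
  have ext: "ext y \<in> cube n" if "y \<in> bits S" for y
    using that by (auto simp: ext_def cube_def PiE_iff)
  have f_ext: "f (ext (restrict x S)) = f x" if "x \<in> cube n" for x
  proof (rule eq)
    have "restrict x S \<in> bits S" using that S(1) by (auto simp: cube_def PiE_iff)
    then show "ext (restrict x S) \<in> cube n" by (rule ext)
  qed (use that S(1) in \<open>auto simp: ext_def\<close>)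
  let ?a = "\<lambda>y. slice_weight n k (card S) (sum y S)"
  let ?b = "\<lambda>y. product_weight p (card S) (sum y S)"
  have U: "S \<union> ({..<n} - S) = {..<n}" using S(1) by blast
  have marg: "(\<Sum>x\<in>cube n. f x * w (card {..<n}) (sum x {..<n}))
      = (\<Sum>y\<in>bits S. f (ext y) * w (card S) (sum y S))" if "coherent n w" for w
  proof -
    have "(\<Sum>x\<in>bits {..<n}. f (ext (restrict x S)) * w (card {..<n}) (sum x {..<n}))
      = (\<Sum>y\<in>bits S. f (ext y) * w (card S) (sum y S))"
      using marginal_of_coherent[OF that, of "{..<n} - S" S "\<lambda>y. f (ext y)"] fin
      unfolding U by simp
    then show ?thesis using f_ext by (simp add: cube_def)
  qed
  have "\<bar>(\<integral>x. f x \<partial>slice_measure n k) - (\<integral>x. f x \<partial>cube_measure n p)\<bar>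
      = \<bar>\<Sum>y\<in>bits S. f (ext y) * (?a y - ?b y)\<bar>"
    unfolding integral_slice_measure[OF kn] integral_cube_measure[OF p]
      marg[OF coherent_slice_weight] marg[OF coherent_product_weight]
    by (simp add: sum_subtractf right_diff_distrib)
  also have "\<dots> \<le> (\<Sum>y\<in>bits S. \<bar>?a y - ?b y\<bar>)"
  proof (rule order_trans[OF sum_abs], rule sum_mono)
    fix y assume "y \<in> bits S"
    then have "\<bar>f (ext y)\<bar> \<le> 1" using ext f by blast
    then show "\<bar>f (ext y) * (?a y - ?b y)\<bar> \<le> \<bar>?a y - ?b y\<bar>"
      by (simp add: abs_mult mult_left_le_one_le)
  qed
  also have "\<dots> \<le> 2 * (real (card S) / (real n - real (card S)))"
  proof (rule power2_le_imp_le)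
    have "(\<Sum>y\<in>bits S. \<bar>?a y - ?b y\<bar>)\<^sup>2 \<le> 4 * slice_entropy n k p S"
      unfolding slice_entropy_def
    proof (rule weak_pinsker)
      show "sum ?a (bits S) = 1"
        using fin S m kn
        by (intro sum_weights_eq_1[OF coherent_slice_weight] slice_weight_0) auto
      show "sum ?b (bits S) = 1"
        by (rule sum_weights_eq_1[OF coherent_product_weight _ fin order_refl])
           (simp add: product_weight_def)
    qed (use p in \<open>auto simp: slice_weight_nonneg product_weight_def\<close>)
    also have "\<dots> \<le> 4 * (real (card S) / (real n - real (card S)))\<^sup>2"
      using slice_entropy_le[OF fin _ kn k p] S m by simp
    finally show "(\<Sum>y\<in>bits S. \<bar>?a y - ?b y\<bar>)\<^sup>2 \<le> (2 * (real (card S) / (real n - real (card S))))\<^sup>2"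
      unfolding power_mult_distrib by simp
  qed (use S m in simp)
  also have "\<dots> \<le> 2 * (real m / (real n - real m))"
    using S m by (intro mult_left_mono frac_le) auto
  finally show ?thesis .
qed

theorem theorem7p2:
  fixes N :: "nat \<Rightarrow> nat"
    and p :: "nat \<Rightarrow> real"
    and m :: "nat \<Rightarrow> nat"
    and f :: "nat \<Rightarrow> (nat \<Rightarrow> nat) \<Rightarrow> real"
  assumes "\<And>n. n \<in> range N \<Longrightarrow> 0 < p n \<and> p n < 1"
    and "\<And>n. n \<in> range N \<Longrightarrow> p n * real n \<in> \<int>"
    and "filterlim (\<lambda>j. p (N j) * (1 - p (N j)) * real (N j)) at_top sequentially"
    and "\<And>n x. n \<in> range N \<Longrightarrow> x \<in> cube n \<Longrightarrow> \<bar>f n x\<bar> \<le> 1"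
    and "\<And>n. n \<in> range N \<Longrightarrow> depends_on_at_most n (m n) (f n)"
    and "(\<lambda>j. real (m (N j))) \<in> o(\<lambda>j. p (N j) * (1 - p (N j)) * real (N j))"
  shows "(\<lambda>j. \<bar>(\<integral>x. f (N j) x \<partial>slice_measure (N j) (nat \<lfloor>p (N j) * real (N j)\<rfloor>))
              - (\<integral>x. f (N j) x \<partial>cube_measure (N j) (p (N j)))\<bar>) \<in> o(\<lambda>_. 1)"
proof (rule landau_o.smallI)
  fix c :: real assume c: "c > 0"
  \<comment> \<open>If \<open>m \<le> e * n\<close> with \<open>e \<le> 1 / 2\<close>, then \<open>n - m \<ge> n / 2\<close> and the bound of \<open>slice_vs_cube\<close>
      is at most \<open>4 * e\<close>.\<close>
  define e where "e = min (1 / 2) (c / 4)"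
  have e: "e > 0" "e \<le> 1 / 2" "4 * e \<le> c" using c by (auto simp: e_def)
  have "\<forall>\<^sub>F j in sequentially. norm (real (m (N j))) \<le> e * norm (p (N j) * (1 - p (N j)) * real (N j))"
    using assms(6) e(1) by (rule landau_o.smallD)
  moreover have "\<forall>\<^sub>F j in sequentially. 0 < p (N j) * (1 - p (N j)) * real (N j)"
    using assms(3) by (simp add: filterlim_at_top_dense)
  ultimately show "\<forall>\<^sub>F j in sequentially.
      norm (\<bar>(\<integral>x. f (N j) x \<partial>slice_measure (N j) (nat \<lfloor>p (N j) * real (N j)\<rfloor>))
              - (\<integral>x. f (N j) x \<partial>cube_measure (N j) (p (N j)))\<bar>) \<le> c * norm (1 :: real)"
  proof eventually_elim
    case (elim j)
    let ?n = "N j" and ?p = "p (N j)" and ?m = "m (N j)"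
    have p: "0 < ?p" "?p < 1" using assms(1)[of ?n] by auto
    have n: "0 < real ?n" using elim(2) by (cases "?n = 0") auto
    have "?p * (1 - ?p) \<le> 1 * 1" using p by (intro mult_mono) auto
    then have "?p * (1 - ?p) * real ?n \<le> 1 * real ?n" using n by (intro mult_right_mono) auto
    then have "e * (?p * (1 - ?p) * real ?n) \<le> e * real ?n" using e by simp
    then have m: "real ?m \<le> e * real ?n" using elim by simp
    have half: "e * real ?n \<le> real ?n / 2" using e n by simp
    have "real (nat \<lfloor>?p * real ?n\<rfloor>) = ?p * real ?n"
    proof -
      have "real_of_int \<lfloor>?p * real ?n\<rfloor> = ?p * real ?n"
        using assms(2)[of ?n] by (auto elim: Ints_cases)
      moreover have "0 \<le> ?p * real ?n" using p by simp
      ultimately show ?thesis by simp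
    qed
    moreover have "?m < ?n" using m half n by linarith
    ultimately have "\<bar>(\<integral>x. f ?n x \<partial>slice_measure ?n (nat \<lfloor>?p * real ?n\<rfloor>))
              - (\<integral>x. f ?n x \<partial>cube_measure ?n ?p)\<bar> \<le> 2 * (real ?m / (real ?n - real ?m))"
      using p assms(4,5) by (intro slice_vs_cube) auto
    also have "\<dots> \<le> 2 * (e * real ?n / (real ?n / 2))"
    proof (intro mult_left_mono frac_le)
      show "real ?n / 2 \<le> real ?n - real ?m" using m half by linarith
    qed (use m n e in auto)
    also have "\<dots> = 4 * e" using n by simp
    finally show ?case using e by simp
  qed
qed

end
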